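(* Let $\tau=(p_1,p_2,p_3,p_4)$ be an ideal tetrahedron with $p_1\neq p_2$ and $p_3,p_4\notin\{p_1,p_2\}$. Then $\tau$ is balanced if and only if the cross-ratio $\mathbb{X}(p_1,p_2,p_3,p_4)$ has unit modulus.
   Context: $\langle\cdot,\cdot\rangle$ is a Hermitian form of signature $(2,1)$ on $\mathbb{C}^3$, linear in the first variable; $\mathbf{H}^2_{\mathbb{C}}$ (resp. $\partial\mathbf{H}^2_{\mathbb{C}}$) is the set of complex lines spanned by negative (resp. non-zero null) vectors, with its complex hyperbolic metric. A lift of a point $p$ is a non-zero vector $\mathbf{p}$ spanning it. An ideal tetrahedron is an ordered $4$-tuple of points of $\partial\mathbf{H}^2_{\mathbb{C}}$. It is balanced if $p_3$ and $p_4$ have the same image under the orthogonal projection $\pi_{12}$ onto the real geodesic $\gamma_{12}$ with endpoints $p_1$ and $p_2$ (the projection being extended continuously to boundary points other than $p_1,p_2$). The cross-ratio is $$\mathbb{X}(p_1,p_2,p_3,p_4)=\frac{\langle\mathbf{p}_3,\mathbf{p}_1\rangle\langle\mathbf{p}_4,\mathbf{p}_2\rangle}{\langle\mathbf{p}_3,\mathbf{p}_2\rangle\langle\mathbf{p}_4,\mathbf{p}_1\rangle}.$$ *)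

theory Defs
  imports "HOL-Analysis.Analysis"
begin

section \<open>Hermitian forms of signature (2,1)\<close>

definition hermitian_form :: "(complex^3 \<Rightarrow> complex^3 \<Rightarrow> complex) \<Rightarrow> bool" where
  "hermitian_form H \<longleftrightarrow>
     (\<forall>u v w. H (u + v) w = H u w + H v w) \<and>
     (\<forall>c u v. H (c *s u) v = c * H u v) \<and>
     (\<forall>u v. H v u = cnj (H u v))"

text \<open>The values \<open>H e e\<close> are real, so \<open>Re\<close> loses nothing here or below.\<close>

definition signature_2_1 :: "(complex^3 \<Rightarrow> complex^3 \<Rightarrow> complex) \<Rightarrow> bool" where
  "signature_2_1 H \<longleftrightarrow>
     (\<exists>e1 e2 e3. vec.span {e1, e2, e3} = UNIV \<and>
        H e1 e2 = 0 \<and> H e1 e3 = 0 \<and> H e2 e3 = 0 \<and>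
        Re (H e1 e1) > 0 \<and> Re (H e2 e2) > 0 \<and> Re (H e3 e3) < 0)"


section \<open>The projective plane\<close>

text \<open>A point is a complex line in \<open>complex^3\<close>, that is, a set of vectors.\<close>

type_synonym point = "(complex^3) set"

definition is_lift :: "point \<Rightarrow> complex^3 \<Rightarrow> bool" where
  "is_lift p v \<longleftrightarrow> v \<noteq> 0 \<and> p = vec.span {v}"

definition lift :: "point \<Rightarrow> complex^3" where
  "lift p = (SOME v. is_lift p v)"

definition CP2 :: "point set" where
  "CP2 = {p. \<exists>v. is_lift p v}"

text \<open>The quotient topology of \<open>UNIV - {0}\<close>; see \<open>quotient_map_cp2\<close> below.\<close>

definition cp2_topology :: "point topology" where
  "cp2_topology =
     topology (\<lambda>U. U \<subseteq> CP2 \<and> open {v. v \<noteq> 0 \<and> vec.span {v} \<in> U})"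

lemma openin_cp2_topology:
  "openin cp2_topology U \<longleftrightarrow> U \<subseteq> CP2 \<and> open {v. v \<noteq> 0 \<and> vec.span {v} \<in> U}"
proof -
  let ?L = "\<lambda>U. {v::complex^3. v \<noteq> 0 \<and> vec.span {v} \<in> U}"
  have "open (?L (S \<inter> T))" if "open (?L S)" "open (?L T)" for S T
  proof -
    have "?L (S \<inter> T) = ?L S \<inter> ?L T" by blast
    then show ?thesis using that by (simp add: open_Int)
  qed
  moreover have "open (?L (\<Union>K))" if "\<forall>S\<in>K. open (?L S)" for K
  proof -
    have "?L (\<Union>K) = (\<Union>S\<in>K. ?L S)" by blast
    then show ?thesis using that by (metis (no_types, lifting) open_UN)
  qed
  ultimately have "istopology (\<lambda>U. U \<subseteq> CP2 \<and> open (?L U))"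
    unfolding istopology_def by (intro conjI allI impI) (blast | simp)+
  then show ?thesis
    unfolding cp2_topology_def by (simp add: topology_inverse')
qed

lemma topspace_cp2_topology [simp]: "topspace cp2_topology = CP2"
proof -
  have "{v::complex^3. v \<noteq> 0 \<and> vec.span {v} \<in> CP2} = - {0}"
    by (auto simp: CP2_def is_lift_def)
  then have "openin cp2_topology CP2"
    by (simp add: openin_cp2_topology open_Compl)
  then show ?thesis
    by (metis openin_cp2_topology openin_subset openin_topspace subset_antisym)
qed

lemma quotient_map_cp2:
  "quotient_map (top_of_set (UNIV - {0})) cp2_topology (\<lambda>v. vec.span {v})"
proof -
  have "openin (top_of_set (UNIV - {0})) {v \<in> UNIV - {0::complex^3}. vec.span {v} \<in> U} \<longleftrightarrow>
      open {v. v \<noteq> 0 \<and> vec.span {v} \<in> U}" for U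
    by (subst openin_open_eq) auto
  then show ?thesis
    unfolding quotient_map_def openin_cp2_topology topspace_cp2_topology
    by (auto simp: CP2_def is_lift_def)
qed


section \<open>The complex hyperbolic plane and its boundary\<close>

definition H2C :: "(complex^3 \<Rightarrow> complex^3 \<Rightarrow> complex) \<Rightarrow> point set" where
  "H2C H = {p. \<exists>v. is_lift p v \<and> Re (H v v) < 0}"

definition bdH2C :: "(complex^3 \<Rightarrow> complex^3 \<Rightarrow> complex) \<Rightarrow> point set" where
  "bdH2C H = {p. \<exists>v. is_lift p v \<and> H v v = 0}"

text \<open>The distance \<open>d\<close> with
  \<open>cosh\<^sup>2 (d(p, q) / 2) = \<langle>p, q\<rangle> \<langle>q, p\<rangle> / (\<langle>p, p\<rangle> \<langle>q, q\<rangle>)\<close>,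
  i.e. the normalisation with sectional curvature between \<open>-1\<close> and \<open>-1/4\<close>.\<close>

definition hdist :: "(complex^3 \<Rightarrow> complex^3 \<Rightarrow> complex) \<Rightarrow> point \<Rightarrow> point \<Rightarrow> real" where
  "hdist H p q =
     (let v = lift p; w = lift q
      in 2 * arcosh (sqrt (Re ((H v w * H w v) / (H v v * H w w)))))"

definition is_geodesic_with_endpoints ::
  "(complex^3 \<Rightarrow> complex^3 \<Rightarrow> complex) \<Rightarrow> point \<Rightarrow> point \<Rightarrow> (real \<Rightarrow> point) \<Rightarrow> bool" where
  "is_geodesic_with_endpoints H p q c \<longleftrightarrow>
     (\<forall>t. c t \<in> H2C H) \<and>
     (\<forall>s t. hdist H (c s) (c t) = \<bar>s - t\<bar>) \<and>
     limitin cp2_topology c p at_bot \<and>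
     limitin cp2_topology c q at_top"

definition geodesic :: "(complex^3 \<Rightarrow> complex^3 \<Rightarrow> complex) \<Rightarrow> point \<Rightarrow> point \<Rightarrow> point set" where
  "geodesic H p q = (THE G. \<exists>c. is_geodesic_with_endpoints H p q c \<and> G = range c)"


section \<open>Orthogonal projection onto a geodesic\<close>

text \<open>In the Hadamard manifold \<open>H2C H\<close>, the orthogonal projection onto a geodesic is
  the nearest-point projection.\<close>

definition proj_geodesic ::
  "(complex^3 \<Rightarrow> complex^3 \<Rightarrow> complex) \<Rightarrow> point \<Rightarrow> point \<Rightarrow> point \<Rightarrow> point" where
  "proj_geodesic H p1 p2 x =
     (THE q. is_arg_min (hdist H x) (\<lambda>q. q \<in> geodesic H p1 p2) q)"

text \<open>The extension by continuity to a boundary point \<open>x\<close> other than \<open>p1\<close>, \<open>p2\<close>: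
  the limit of the projections of points of \<open>H2C H\<close> tending to \<open>x\<close>.\<close>

definition proj_geodesic_bd ::
  "(complex^3 \<Rightarrow> complex^3 \<Rightarrow> complex) \<Rightarrow> point \<Rightarrow> point \<Rightarrow> point \<Rightarrow> point" where
  "proj_geodesic_bd H p1 p2 x =
     (THE q. limitin (subtopology cp2_topology (geodesic H p1 p2)) (proj_geodesic H p1 p2) q
               (atin_within cp2_topology x (H2C H)))"


section \<open>Ideal tetrahedra and the cross-ratio\<close>

definition ideal_tetrahedra ::
  "(complex^3 \<Rightarrow> complex^3 \<Rightarrow> complex) \<Rightarrow> (point \<times> point \<times> point \<times> point) set" where
  "ideal_tetrahedra H = bdH2C H \<times> bdH2C H \<times> bdH2C H \<times> bdH2C H"

text \<open>Meaningful for \<open>p1 \<noteq> p2\<close> and \<open>p3, p4 \<notin> {p1, p2}\<close> only, since otherwise the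
  projections are not defined.\<close>

fun balanced ::
  "(complex^3 \<Rightarrow> complex^3 \<Rightarrow> complex) \<Rightarrow> point \<times> point \<times> point \<times> point \<Rightarrow> bool" where
  "balanced H (p1, p2, p3, p4) \<longleftrightarrow> proj_geodesic_bd H p1 p2 p3 = proj_geodesic_bd H p1 p2 p4"

definition cross_ratio ::
  "(complex^3 \<Rightarrow> complex^3 \<Rightarrow> complex) \<Rightarrow> point \<Rightarrow> point \<Rightarrow> point \<Rightarrow> point \<Rightarrow> complex" where
  "cross_ratio H p1 p2 p3 p4 =
     (H (lift p3) (lift p1) * H (lift p4) (lift p2)) /
     (H (lift p3) (lift p2) * H (lift p4) (lift p1))"

text \<open>Neither the distance nor the cross-ratio depends on the chosen lifts.\<close>

lemma lift_eq_scale: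
  assumes "is_lift p v"
  obtains c where "c \<noteq> 0" "lift p = c *s v"
proof -
  have l: "is_lift p (lift p)"
    unfolding lift_def using assms by (rule someI)
  then have "lift p \<in> vec.span {v}"
    using assms by (metis is_lift_def insertI1 vec.span_base)
  then obtain c where c: "lift p = c *s v"
    by (auto simp: vec.span_singleton)
  moreover have "c \<noteq> 0"
    using l c by (auto simp: is_lift_def)
  ultimately show ?thesis using that by blast
qed

lemma hermitian_form_scale:
  assumes "hermitian_form H"
  shows "H (a *s u) (b *s v) = a * cnj b * H u v"
  using assms unfolding hermitian_form_def
  by (metis (no_types, lifting) complex_cnj_cnj complex_cnj_mult mult.assoc mult.left_commute)

lemma hdist_lifts:
  assumes "hermitian_form H" "is_lift p v" "is_lift q w"
  shows "hdist H p q = 2 * arcosh (sqrt (Re ((H v w * H w v) / (H v v * H w w))))"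
proof -
  obtain a where a: "a \<noteq> 0" "lift p = a *s v" using assms(2) by (rule lift_eq_scale)
  obtain b where b: "b \<noteq> 0" "lift q = b *s w" using assms(3) by (rule lift_eq_scale)
  have "a * cnj b * H v w * (b * cnj a * H w v) / (a * cnj a * H v v * (b * cnj b * H w w)) =
      (a * cnj a * b * cnj b) * (H v w * H w v) / ((a * cnj a * b * cnj b) * (H v v * H w w))"
    by (simp add: mult_ac)
  also have "\<dots> = H v w * H w v / (H v v * H w w)"
    using a(1) b(1) by (subst mult_divide_mult_cancel_left) auto
  finally show ?thesis
    unfolding hdist_def Let_def a(2) b(2) hermitian_form_scale[OF assms(1)] by (rule arg_cong)
qed

lemma cross_ratio_lifts:
  assumes "hermitian_form H" "is_lift p1 v1" "is_lift p2 v2" "is_lift p3 v3" "is_lift p4 v4"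
  shows "cross_ratio H p1 p2 p3 p4 = (H v3 v1 * H v4 v2) / (H v3 v2 * H v4 v1)"
proof -
  obtain a where a: "a \<noteq> 0" "lift p1 = a *s v1" using assms(2) by (rule lift_eq_scale)
  obtain b where b: "b \<noteq> 0" "lift p2 = b *s v2" using assms(3) by (rule lift_eq_scale)
  obtain c where c: "c \<noteq> 0" "lift p3 = c *s v3" using assms(4) by (rule lift_eq_scale)
  obtain d where d: "d \<noteq> 0" "lift p4 = d *s v4" using assms(5) by (rule lift_eq_scale)
  have "(c * cnj a * H v3 v1 * (d * cnj b * H v4 v2)) / (c * cnj b * H v3 v2 * (d * cnj a * H v4 v1))
      = ((c * cnj a * d * cnj b) * (H v3 v1 * H v4 v2)) / ((c * cnj a * d * cnj b) * (H v3 v2 * H v4 v1))"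
    by (simp add: mult_ac)
  also have "\<dots> = (H v3 v1 * H v4 v2) / (H v3 v2 * H v4 v1)"
    using a(1) b(1) c(1) d(1) by (subst mult_divide_mult_cancel_left) auto
  finally show ?thesis
    unfolding cross_ratio_def a(2) b(2) c(2) d(2) hermitian_form_scale[OF assms(1)] .
qed

end

theory Submission
  imports Defs "HOL-Real_Asymp.Real_Asymp"
begin

text \<open>
  Choose null lifts \<open>v1\<close>, \<open>v2\<close> of \<open>p1\<close>, \<open>p2\<close> with \<open>\<langle>v1, v2\<rangle> = -1\<close>. The orthogonal complement of
  their span is positive definite, and the geodesic \<open>\<gamma>\<^sub>1\<^sub>2\<close> consists of the lines spanned by the
  vectors \<open>r v1 + v2\<close> with \<open>r > 0\<close>. For a negative vector \<open>x\<close> the squared hyperbolic cosine of half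
  the distance from the line of \<open>x\<close> to the point with parameter \<open>r\<close> is, up to a factor and a summand
  independent of \<open>r\<close>, equal to \<open>r |\<langle>x, v1\<rangle>|\<^sup>2 + |\<langle>x, v2\<rangle>|\<^sup>2 / r\<close>. Hence the nearest point has
  parameter \<open>h(x) = |\<langle>x, v2\<rangle>| / |\<langle>x, v1\<rangle>|\<close> (\<open>proj_geodesic_eq\<close>). This formula is continuous at every
  boundary point other than \<open>p1\<close> and \<open>p2\<close>, so it also describes the extended projection
  (\<open>proj_geodesic_bd_eq\<close>). Balancedness therefore means \<open>h(x3) = h(x4)\<close>, and \<open>h(x4) / h(x3)\<close>
  is the modulus of the cross-ratio.

  What takes most effort is that the geodesic is determined by its endpoints
  (\<open>geodesic_on_axis\<close>). Let \<open>c\<close> be an isometrically embedded line from \<open>p1\<close> to \<open>p2\<close>,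
  with lifts \<open>C(s)\<close> of norm \<open>-1\<close>. Comparing the distances of \<open>c(0)\<close> and \<open>c(s)\<close> to points of \<open>c\<close>
  running to either end (\<open>busemann_ratio\<close>) shows that \<open>|\<langle>C(s), v1\<rangle>|\<close> and \<open>|\<langle>C(s), v2\<rangle>|\<close> are
  constant multiples of \<open>exp(s/2)\<close> and \<open>exp(-s/2)\<close>. Let \<open>K\<close> be their product, which does not depend
  on \<open>s\<close>. The component of \<open>C(s)\<close> orthogonal to \<open>v1\<close> and \<open>v2\<close> has norm at most \<open>2K - 1\<close>, so that
  \<open>\<langle>C(s), C(-s)\<rangle>\<close> grows like \<open>K exp(s)\<close>; but its modulus is \<open>cosh s\<close>, whence \<open>K \<le> 1/2\<close>. Then the
  orthogonal component vanishes and \<open>c(s)\<close> is one of the points above.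
\<close>

section \<open>Lifts and limits in the projective plane\<close>

lemma span_singleton_scale:
  fixes v :: "complex^3"
  assumes "c \<noteq> 0"
  shows "vec.span {c *s v} = vec.span {v}"
proof (rule vec.span_eq[THEN iffD2], intro conjI)
  show "{c *s v} \<subseteq> vec.span {v}"
    by (auto simp: vec.span_singleton)
  have "v = inverse c *s (c *s v)"
    using assms by (simp add: vector_smult_assoc)
  then show "{v} \<subseteq> vec.span {c *s v}"
    by (auto simp: vec.span_singleton)
qed

lemma is_lift_proportional:
  assumes "is_lift p v" "is_lift p w"
  obtains c where "c \<noteq> 0" "w = c *s v"
proof -
  have "w \<in> vec.span {v}"
    using assms by (metis is_lift_def insertI1 vec.span_base)
  then obtain c where c: "w = c *s v"
    by (auto simp: vec.span_singleton)
  moreover have "c \<noteq> 0"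
    using c assms by (auto simp: is_lift_def)
  ultimately show ?thesis using that by blast
qed

lemma is_lift_scale: "is_lift p v \<Longrightarrow> c \<noteq> 0 \<Longrightarrow> is_lift p (c *s v)"
  by (auto simp: is_lift_def span_singleton_scale)

lemma open_vimage_scale:
  fixes S :: "(complex^3) set"
  assumes "open S"
  shows "open {v. c *s v \<in> S}"
proof -
  have "continuous_on UNIV (\<lambda>v::complex^3. c *s v)"
    unfolding vector_scalar_mult_def by (intro continuous_intros)
  then have "open ((\<lambda>v::complex^3. c *s v) -` S)"
    using assms open_vimage by blast
  then show ?thesis by (simp add: vimage_def)
qed

text \<open>The quotient map onto the projective plane is open, because the saturation of an open set of
  vectors is the union of its rescalings.\<close>

lemma openin_cp2_image:
  assumes "open S"
  shows "openin cp2_topology {p. \<exists>w\<in>S. is_lift p w}"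
proof -
  have "{v. v \<noteq> 0 \<and> vec.span {v} \<in> {p. \<exists>w\<in>S. is_lift p w}} = (\<Union>c\<in>-{0}. {v. c *s v \<in> S}) - {0}"
    (is "?L = ?R")
  proof (intro set_eqI iffI)
    fix v assume "v \<in> ?L"
    then obtain w where w: "w \<in> S" "is_lift (vec.span {v}) w" "v \<noteq> 0" by auto
    then obtain c where "c \<noteq> 0" "w = c *s v"
      using is_lift_proportional[of "vec.span {v}" v w] by (auto simp: is_lift_def)
    then show "v \<in> ?R" using w by auto
  next
    fix v assume "v \<in> ?R"
    then obtain c where c: "c \<noteq> 0" "c *s v \<in> S" "v \<noteq> 0" by auto
    then have "is_lift (vec.span {v}) (c *s v)" by (auto simp: is_lift_def span_singleton_scale)
    then show "v \<in> ?L" using c by auto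
  qed
  moreover have "open ?R"
    using assms by (intro open_Diff open_UN ballI open_vimage_scale) auto
  ultimately show ?thesis
    by (auto simp: openin_cp2_topology CP2_def)
qed

text \<open>Functions of degree zero descend to the projective plane, so their limits can be computed on
  arbitrary lifts; the lifts \<open>w t\<close> themselves need not converge.\<close>

lemma tendsto_of_limitin_cp2:
  fixes \<phi> :: "complex^3 \<Rightarrow> 'b::topological_space"
  assumes lim: "limitin cp2_topology f p F"
    and lifts: "eventually (\<lambda>t. is_lift (f t) (w t)) F"
    and p: "is_lift p v"
    and cont: "isCont \<phi> v"
    and inv: "\<And>c u. c \<noteq> 0 \<Longrightarrow> \<phi> (c *s u) = \<phi> u"
  shows "((\<lambda>t. \<phi> (w t)) \<longlongrightarrow> \<phi> v) F"
proof (rule topological_tendstoI)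
  fix U assume U: "open U" "\<phi> v \<in> U"
  from cont have "(\<phi> \<longlongrightarrow> \<phi> v) (nhds v)"
    by (simp add: isCont_def tendsto_at_iff_tendsto_nhds)
  then have "eventually (\<lambda>x. \<phi> x \<in> U) (nhds v)"
    using U by (rule topological_tendstoD)
  then obtain S where S: "open S" "v \<in> S" "\<And>x. x \<in> S \<Longrightarrow> \<phi> x \<in> U"
    by (auto simp: eventually_nhds)
  let ?U = "{p. \<exists>w\<in>S. is_lift p w}"
  have "eventually (\<lambda>t. f t \<in> ?U) F"
    using lim openin_cp2_image[OF S(1)] p S(2) unfolding limitin_def by blast
  then show "eventually (\<lambda>t. \<phi> (w t) \<in> U) F"
    using lifts
  proof eventually_elim
    case (elim t)
    then obtain u where u: "u \<in> S" "is_lift (f t) u" by blast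
    then obtain c where "c \<noteq> 0" "u = c *s w t"
      using is_lift_proportional elim(2) by blast
    then show ?case using S(3)[OF u(1)] inv by simp
  qed
qed

lemma limitin_cp2_span:
  assumes "(w \<longlongrightarrow> v) F" "v \<noteq> 0"
  shows "limitin cp2_topology (\<lambda>t. vec.span {w t}) (vec.span {v}) F"
  unfolding limitin_def
proof (intro conjI allI impI)
  show "vec.span {v} \<in> topspace cp2_topology"
    using assms by (auto simp: CP2_def is_lift_def)
next
  fix U assume "openin cp2_topology U \<and> vec.span {v} \<in> U"
  then have "open {v. v \<noteq> 0 \<and> vec.span {v} \<in> U}" "v \<in> {v. v \<noteq> 0 \<and> vec.span {v} \<in> U}"
    using assms by (auto simp: openin_cp2_topology)
  from topological_tendstoD[OF assms(1) this]
  show "\<forall>\<^sub>F t in F. vec.span {w t} \<in> U"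
    by eventually_elim auto
qed

section \<open>Hermitian forms of signature (2,1)\<close>

locale signature_21_form =
  fixes H :: "complex^3 \<Rightarrow> complex^3 \<Rightarrow> complex"
  assumes herm: "hermitian_form H"
    and sign: "signature_2_1 H"
begin

lemma add_left: "H (u + v) w = H u w + H v w"
  and scale_left: "H (c *s u) v = c * H u v"
  and conj_sym: "H v u = cnj (H u v)"
  using herm unfolding hermitian_form_def by blast+

lemma add_right: "H w (u + v) = H w u + H w v"
  by (metis add_left conj_sym complex_cnj_add)

lemma scale_right: "H u (c *s v) = cnj c * H u v"
  by (metis scale_left conj_sym complex_cnj_mult)

lemma zero_left [simp]: "H 0 v = 0"
  using scale_left[of 0 0 v] by simp

lemma zero_right [simp]: "H v 0 = 0"
  by (metis conj_sym zero_left complex_cnj_zero)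

lemma uminus_left: "H (- u) v = - H u v"
  using scale_left[of "-1" u v] by simp

lemma uminus_right: "H u (- v) = - H u v"
  using scale_right[of u "-1" v] by simp

lemma diff_left: "H (u - v) w = H u w - H v w"
  using add_left[of u "- v" w] by (simp add: uminus_left)

lemma diff_right: "H w (u - v) = H w u - H w v"
  using add_right[of w u "- v"] by (simp add: uminus_right)

lemmas form_simps = add_left add_right diff_left diff_right scale_left scale_right

lemma self_real: "H v v = of_real (Re (H v v))"
  by (metis conj_sym cnj.simps(2) complex_eq_iff equal_neg_zero Re_complex_of_real Im_complex_of_real)

lemma self_scale: "Re (H (c *s v) (c *s v)) = (cmod c)\<^sup>2 * Re (H v v)"
proof -
  have "H (c *s v) (c *s v) = of_real ((cmod c)\<^sup>2) * H v v"
    unfolding complex_norm_square by (simp add: form_simps mult_ac)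
  then show ?thesis by simp
qed

lemma mult_swap: "H u v * H v u = of_real ((cmod (H u v))\<^sup>2)"
  by (metis conj_sym complex_norm_square)

lemma norm_swap: "cmod (H u v) = cmod (H v u)"
  by (metis conj_sym complex_mod_cnj)

lemma isCont_form: "isCont (\<lambda>w. H w y) v"
proof -
  have "linear (\<lambda>w. H w y)"
  proof (rule linearI)
    show "H (u + v) y = H u y + H v y" for u v by (rule add_left)
    have "r *\<^sub>R u = of_real r *s u" for r :: real and u :: "complex^3"
      unfolding vec_eq_iff by (simp add: scaleR_conv_of_real[where 'a=complex])
    then show "H (r *\<^sub>R u) y = r *\<^sub>R H u y" for r :: real and u
      by (simp add: scale_left scaleR_conv_of_real[where 'a=complex])
  qed
  then show ?thesis
    by (simp add: linear_conv_bounded_linear linear_continuous_at)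
qed

text \<open>The negative vector of an orthogonal basis has this property. The other facts about the signature
  are derived from it.\<close>

lemma exists_positive_perp:
  obtains e where "\<And>w. H w e = 0 \<Longrightarrow> w \<noteq> 0 \<Longrightarrow> Re (H w w) > 0"
proof -
  obtain e1 e2 e3 where e: "vec.span {e1, e2, e3} = UNIV"
    "H e1 e2 = 0" "H e1 e3 = 0" "H e2 e3 = 0"
    "Re (H e1 e1) > 0" "Re (H e2 e2) > 0" "Re (H e3 e3) < 0"
    using sign unfolding signature_2_1_def by blast
  have "Re (H w w) > 0" if w: "H w e3 = 0" "w \<noteq> 0" for w
  proof -
    have "w \<in> vec.span {e1, e2, e3}" using e(1) by simp
    then obtain a b c where "w - a *s e1 - b *s e2 = c *s e3"
      by (auto simp: vec.span_insert vec.span_singleton)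
    then have weq: "w = a *s e1 + b *s e2 + c *s e3"
      by (metis add.commute diff_add_cancel diff_diff_add)
    have "c * H e3 e3 = 0"
      using w(1) e unfolding weq by (simp add: form_simps)
    then have "c = 0" using e(7) by auto
    then have weq: "w = a *s e1 + b *s e2" using weq by simp
    have "H e2 e1 = 0" using e(2) conj_sym[of e2 e1] by simp
    then have "H w w = H (a *s e1) (a *s e1) + H (b *s e2) (b *s e2)"
      using e unfolding weq by (simp add: form_simps)
    then have eq: "Re (H w w) = (cmod a)\<^sup>2 * Re (H e1 e1) + (cmod b)\<^sup>2 * Re (H e2 e2)"
      by (simp only: plus_complex.sel self_scale)
    have "a \<noteq> 0 \<or> b \<noteq> 0" using w(2) weq by auto
    then show ?thesis
      unfolding eq using e(5,6)
      by (cases "a = 0") (auto intro!: add_pos_nonneg)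
  qed
  then show ?thesis using that by blast
qed

text \<open>Two orthogonal vectors of norm at most zero span a space on which the form is negative
  semidefinite. If they were independent, this plane would meet the positive definite hyperplane of
  \<open>exists_positive_perp\<close> in a non-zero vector. Two consequences follow: distinct boundary points have
  non-orthogonal lifts, and the complement of every negative vector is positive definite.\<close>

lemma orthogonal_nonpositive_dependent:
  assumes "H u w = 0" "Re (H u u) \<le> 0" "Re (H w w) \<le> 0" "u \<noteq> 0" "w \<noteq> 0"
  obtains c where "c \<noteq> 0" "w = c *s u"
proof -
  obtain e where e: "\<And>w. H w e = 0 \<Longrightarrow> w \<noteq> 0 \<Longrightarrow> Re (H w w) > 0"
    using exists_positive_perp by blast
  define a b where "a = H w e" and "b = H u e"
  have ab: "a \<noteq> 0" "b \<noteq> 0" using e[of u] e[of w] assms by (auto simp: a_def b_def)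
  \<comment> \<open>the coefficients are chosen so that \<open>?x\<close> is orthogonal to \<open>e\<close>\<close>
  let ?x = "a *s u - b *s w"
  have "H w u = 0" using assms(1) conj_sym[of w u] by simp
  then have "H ?x ?x = H (a *s u) (a *s u) + H (b *s w) (b *s w)"
    using assms(1) by (simp add: form_simps)
  then have "Re (H ?x ?x) = (cmod a)\<^sup>2 * Re (H u u) + (cmod b)\<^sup>2 * Re (H w w)"
    by (simp only: plus_complex.sel self_scale)
  also have "\<dots> \<le> 0"
    using assms by (intro add_nonpos_nonpos mult_nonneg_nonpos) auto
  finally have "Re (H ?x ?x) \<le> 0" .
  moreover have "H ?x e = 0" by (simp add: form_simps a_def b_def)
  ultimately have "?x = 0" using e[of ?x] by force
  then have "b *s w = a *s u" by simp
  then have "w = inverse b *s (a *s u)"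
    using ab by (metis vector_smult_assoc left_inverse vector_smult_lid)
  then have "w = (inverse b * a) *s u" by (simp add: vector_smult_assoc)
  then show ?thesis using ab that[of "inverse b * a"] by simp
qed

lemma perp_negative_positive:
  assumes "Re (H n n) < 0" "H w n = 0" "w \<noteq> 0"
  shows "Re (H w w) > 0"
proof (rule ccontr)
  assume "\<not> ?thesis"
  moreover have "n \<noteq> 0" using assms(1) by auto
  ultimately obtain c where c: "c \<noteq> 0" "n = c *s w"
    using orthogonal_nonpositive_dependent[of w n] assms by auto
  then have "H n n = c * H w n" by (simp add: scale_left)
  then show False using assms by simp
qed

lemma null_negative_nonzero:
  assumes "H w w = 0" "w \<noteq> 0" "Re (H n n) < 0"
  shows "H w n \<noteq> 0"
  using perp_negative_positive[of n w] assms by auto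

text \<open>The component of \<open>v\<close> orthogonal to \<open>w\<close> has non-negative norm. This makes the argument of
  \<open>arcosh\<close> in the distance at least \<open>1\<close>, where \<open>arcosh\<close> inverts \<open>cosh\<close>.\<close>

lemma reverse_cauchy_schwarz:
  assumes "Re (H v v) < 0" "Re (H w w) < 0"
  shows "Re (H v v) * Re (H w w) \<le> (cmod (H v w))\<^sup>2"
proof -
  let ?u = "H w w *s v - H v w *s w"
  have perp: "H ?u w = 0" by (simp add: form_simps)
  then have ge: "Re (H ?u ?u) \<ge> 0"
    using perp_negative_positive[OF assms(2), of ?u] by (cases "?u = 0") auto
  have "H ?u ?u = cnj (H w w) * H ?u v"
    using perp by (simp add: diff_right scale_right)
  also have "\<dots> = H w w * (H w w * H v v - H v w * H w v)"
    by (simp add: form_simps conj_sym[symmetric])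
  also have "\<dots> = of_real (Re (H w w) * (Re (H w w) * Re (H v v) - (cmod (H v w))\<^sup>2))"
    unfolding mult_swap by (subst (1 2 3) self_real) simp
  finally have "Re (H ?u ?u) = Re (H w w) * (Re (H w w) * Re (H v v) - (cmod (H v w))\<^sup>2)"
    by (metis Re_complex_of_real)
  with ge have "Re (H w w) * Re (H v v) - (cmod (H v w))\<^sup>2 \<le> 0"
    using assms(2) by (simp add: zero_le_mult_iff)
  then show ?thesis by (simp add: mult.commute)
qed

lemma cosh_hdist:
  assumes "is_lift p v" "is_lift q w" "Re (H v v) < 0" "Re (H w w) < 0"
  shows "(cosh (hdist H p q / 2))\<^sup>2 = (cmod (H v w))\<^sup>2 / (Re (H v v) * Re (H w w))"
    and "hdist H p q \<ge> 0"
proof -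
  define Q where "Q = (cmod (H v w))\<^sup>2 / (Re (H v v) * Re (H w w))"
  have pos: "Re (H v v) * Re (H w w) > 0" using assms by (simp add: mult_neg_neg)
  have Q: "Q \<ge> 1"
    unfolding Q_def using reverse_cauchy_schwarz[OF assms(3,4)] pos by simp
  have "H v w * H w v / (H v v * H w w) = of_real Q"
    unfolding mult_swap Q_def by (subst (1 2) self_real) simp
  then have d: "hdist H p q = 2 * arcosh (sqrt Q)"
    using hdist_lifts[OF herm assms(1,2)] by simp
  have "cosh (arcosh (sqrt Q)) = sqrt Q"
    using Q by (intro cosh_arcosh_real) simp
  then show "(cosh (hdist H p q / 2))\<^sup>2 = (cmod (H v w))\<^sup>2 / (Re (H v v) * Re (H w w))"
    using Q by (simp add: d Q_def[symmetric])
  show "hdist H p q \<ge> 0"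
    using Q arcosh_nonneg_real[of "sqrt Q"] by (simp add: d)
qed

lemma H2C_unit_lift:
  assumes "p \<in> H2C H"
  obtains v where "is_lift p v" "Re (H v v) = -1"
proof -
  obtain v where v: "is_lift p v" "Re (H v v) < 0"
    using assms by (auto simp: H2C_def)
  let ?c = "of_real (1 / sqrt (- Re (H v v))) :: complex"
  have "?c \<noteq> 0" using v by simp
  moreover have "Re (H (?c *s v) (?c *s v)) = -1"
    unfolding self_scale norm_of_real using v(2) by (simp add: power_divide)
  ultimately show ?thesis using v that is_lift_scale by blast
qed

lemma null_not_negative:
  assumes "p \<in> bdH2C H"
  shows "p \<notin> H2C H"
proof
  assume "p \<in> H2C H"
  then obtain n where n: "is_lift p n" "Re (H n n) < 0" by (auto simp: H2C_def)
  obtain v where v: "is_lift p v" "H v v = 0" using assms by (auto simp: bdH2C_def)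
  obtain c where "n = c *s v" using is_lift_proportional[OF v(1) n(1)] by blast
  then show False using n v by (simp add: form_simps)
qed

lemma lift_H2C:
  assumes "p \<in> H2C H"
  shows "is_lift p (lift p)" "Re (H (lift p) (lift p)) < 0"
proof -
  obtain n where n: "is_lift p n" "Re (H n n) < 0" using assms by (auto simp: H2C_def)
  then obtain c where c: "c \<noteq> 0" "lift p = c *s n" using lift_eq_scale by blast
  then show "is_lift p (lift p)" using n is_lift_scale by simp
  show "Re (H (lift p) (lift p)) < 0"
    unfolding c self_scale using n c by (simp add: mult_pos_neg)
qed

text \<open>Write \<open>v\<close> for a lift of an endpoint. The limit of \<open>|\<langle>C(t), C(0)\<rangle>| / |\<langle>C(t), C(s)\<rangle>|\<close> along \<open>F\<close>
  can be read off from the distances on the geodesic. The quotient has degree zero in \<open>C(t)\<close>, so the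
  limit is also its value at \<open>v\<close>. The conclusion says how the Busemann function of \<open>p\<close> varies along \<open>c\<close>.\<close>

lemma busemann_ratio:
  assumes lifts: "\<And>t. is_lift (c t) (C t)"
    and neg: "\<And>t. Re (H (C t) (C t)) < 0"
    and prods: "\<And>s t. cmod (H (C s) (C t)) = cosh ((s - t) / 2)"
    and lim: "limitin cp2_topology c p F"
    and v: "is_lift p v" "H v v = 0"
    and L: "((\<lambda>t. cosh (t / 2) / cosh ((t - s) / 2)) \<longlongrightarrow> L) F"
    and F: "F \<noteq> bot"
  shows "cmod (H (C 0) v) = L * cmod (H (C s) v)"
proof -
  let ?\<phi> = "\<lambda>w. cmod (H w (C 0)) / cmod (H w (C s))"
  have nz: "H v (C t) \<noteq> 0" for t
    using v neg null_negative_nonzero by (auto simp: is_lift_def)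
  have "((\<lambda>t. ?\<phi> (C t)) \<longlongrightarrow> ?\<phi> v) F"
    using lim _ v(1)
  proof (rule tendsto_of_limitin_cp2)
    show "\<forall>\<^sub>F t in F. is_lift (c t) (C t)" using lifts by simp
    show "isCont ?\<phi> v" using nz by (intro continuous_intros isCont_form) auto
    show "?\<phi> (c *s u) = ?\<phi> u" if "c \<noteq> 0" for c u
      using that by (simp add: scale_left norm_mult)
  qed
  then have "((\<lambda>t. cosh (t / 2) / cosh ((t - s) / 2)) \<longlongrightarrow> ?\<phi> v) F"
    by (simp add: prods)
  then have "?\<phi> v = L" using L F tendsto_unique by blast
  then show ?thesis using nz[of s] by (simp add: norm_swap[of "C _"] field_simps)
qed

end

section \<open>Coordinates adapted to two boundary points\<close>

locale null_pair = signature_21_form +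
  fixes v1 v2 :: "complex^3"
  assumes null [simp]: "H v1 v1 = 0" "H v2 v2 = 0"
    and prod [simp]: "H v1 v2 = -1"
begin

lemma prod' [simp]: "H v2 v1 = -1"
  using conj_sym[of v2 v1] by simp

lemma nonzero: "v1 \<noteq> 0" "v2 \<noteq> 0"
  using prod by (auto simp del: prod)

definition axis_vec :: "real \<Rightarrow> complex^3" where
  "axis_vec r = of_real r *s v1 + v2"

definition axis_point :: "real \<Rightarrow> point" where
  "axis_point r = vec.span {axis_vec r}"

text \<open>For \<open>r \<ge> 0\<close> the vector \<open>axis_vec r\<close> has height \<open>r\<close>; for a negative vector the height will be
  the parameter of the nearest point on the geodesic.\<close>

definition height :: "complex^3 \<Rightarrow> real" where
  "height x = cmod (H x v2) / cmod (H x v1)"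

text \<open>The orthogonal projection to the complement of \<open>v1\<close> and \<open>v2\<close>; the signs come from
  \<open>H v1 v2 = -1\<close>.\<close>

definition transverse :: "complex^3 \<Rightarrow> complex^3" where
  "transverse x = x + H x v2 *s v1 + H x v1 *s v2"

lemma axis_vec_prods:
  "H (axis_vec r) v1 = -1" "H (axis_vec r) v2 = - of_real r"
  "H (axis_vec r) (axis_vec r') = - of_real (r + r')"
  "H x (axis_vec r) = of_real r * H x v1 + H x v2"
  by (simp_all add: axis_vec_def form_simps)

lemma axis_vec_nonzero: "axis_vec r \<noteq> 0"
  using axis_vec_prods(1)[of r] by auto

lemma is_lift_axis: "is_lift (axis_point r) (axis_vec r)"
  by (simp add: is_lift_def axis_point_def axis_vec_nonzero)

lemma height_axis: "r \<ge> 0 \<Longrightarrow> height (axis_vec r) = r"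
  by (simp add: height_def axis_vec_prods)

lemma height_scale: "c \<noteq> 0 \<Longrightarrow> height (c *s x) = height x"
  by (simp add: height_def scale_left norm_mult)

lemma isCont_height: "H x v1 \<noteq> 0 \<Longrightarrow> isCont height x"
  unfolding height_def[abs_def] by (intro continuous_intros isCont_form) auto

lemma axis_point_inject:
  assumes "axis_point r = axis_point r'" "r \<ge> 0" "r' \<ge> 0"
  shows "r = r'"
  using is_lift_proportional[OF is_lift_axis[of r] is_lift_axis[of r', folded assms(1)]]
    height_scale height_axis assms(2,3) by metis

lemma axis_point_H2C: "r > 0 \<Longrightarrow> axis_point r \<in> H2C H"
  unfolding H2C_def using is_lift_axis[of r] by (auto simp: axis_vec_prods intro!: exI[of _ "axis_vec r"])

lemma transverse_perp: "H (transverse x) v1 = 0" "H (transverse x) v2 = 0"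
  by (simp_all add: transverse_def form_simps)

lemma transverse_prod:
  "H (transverse x) (transverse y) = H x y + H x v1 * cnj (H y v2) + H x v2 * cnj (H y v1)"
proof -
  have "H (transverse x) (transverse y) = H (transverse x) y"
    unfolding transverse_def[of y] by (simp add: form_simps transverse_perp)
  then show ?thesis
    by (simp add: transverse_def form_simps conj_sym[symmetric])
qed

lemma transverse_norm:
  "Re (H (transverse x) (transverse x)) = Re (H x x) + 2 * Re (H x v1 * cnj (H x v2))"
  by (simp add: transverse_prod)

text \<open>A vector orthogonal to \<open>v1\<close> and \<open>v2\<close> is orthogonal to the negative vector \<open>v1 + v2\<close>.\<close>

lemma perp_positive:
  assumes "H w v1 = 0" "H w v2 = 0" "w \<noteq> 0"
  shows "Re (H w w) > 0"
  using perp_negative_positive[of "axis_vec 1" w] assms by (simp add: axis_vec_prods)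

lemma perp_nonneg:
  assumes "H w v1 = 0" "H w v2 = 0"
  shows "Re (H w w) \<ge> 0"
  using perp_positive[OF assms] by (cases "w = 0") auto

text \<open>Expand the norm of \<open>u - z w\<close>, where the unit scalar \<open>z\<close> has the phase of \<open>H u w\<close>. This additive form
  of the Cauchy-Schwarz inequality is enough for a bound on transverse components.\<close>

lemma perp_prod_bound:
  assumes "H u v1 = 0" "H u v2 = 0" "H w v1 = 0" "H w v2 = 0"
  shows "2 * cmod (H u w) \<le> Re (H u u) + Re (H w w)"
proof (cases "H u w = 0")
  case True
  then show ?thesis using perp_nonneg assms by simp
next
  case False
  define z where "z = sgn (H u w)"
  have z: "cmod z = 1" using False by (simp add: z_def norm_sgn)
  have zz: "z * cnj z = 1" using z by (simp add: complex_norm_square[symmetric])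
  have "H u w = of_real (cmod (H u w)) * z"
    using False by (simp add: z_def sgn_eq)
  then have zu: "cnj z * H u w = of_real (cmod (H u w))"
    using zz by (metis mult.assoc mult.commute mult_1_right)
  then have zw: "z * H w u = of_real (cmod (H u w))"
    by (metis conj_sym complex_cnj_cnj complex_cnj_complex_of_real complex_cnj_mult)
  let ?x = "u - z *s w"
  have "H ?x ?x = H u u - cnj z * H u w - z * H w u + z * cnj z * H w w"
    by (simp add: form_simps algebra_simps)
  then have "Re (H ?x ?x) = Re (H u u) + Re (H w w) - 2 * cmod (H u w)"
    by (simp add: zu zw zz)
  moreover have "Re (H ?x ?x) \<ge> 0"
    using assms by (intro perp_nonneg) (simp_all add: form_simps)
  ultimately show ?thesis by simp
qed

text \<open>The hypothesis says that the transverse component has norm at most zero.\<close>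

lemma transverse_zero:
  assumes "Re (H x x) + 2 * Re (H x v1 * cnj (H x v2)) \<le> 0"
  shows "x = - (H x v2 *s v1 + H x v1 *s v2)"
proof -
  have "transverse x = 0"
    using assms perp_positive[OF transverse_perp, of x] by (force simp: transverse_norm)
  then show ?thesis
    unfolding transverse_def by (metis add.assoc eq_neg_iff_add_eq_0)
qed

text \<open>If one coordinate of a null vector vanishes, its transverse component is null, hence zero, and the
  vector is a multiple of \<open>v1\<close> or \<open>v2\<close>.\<close>

lemma null_coordinates_nonzero:
  assumes "is_lift p x" "H x x = 0" "p \<noteq> vec.span {v1}" "p \<noteq> vec.span {v2}"
  shows "H x v1 \<noteq> 0" "H x v2 \<noteq> 0"
proof -
  have eq: "x = - (H x v2 *s v1 + H x v1 *s v2)" if "H x v1 = 0 \<or> H x v2 = 0"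
    using assms(2) that by (intro transverse_zero) auto
  have span: "vec.span {c *s v} \<noteq> p" if "c *s v = x" "p \<noteq> vec.span {v}" for c v
    using that assms(1) by (cases "c = 0") (auto simp: is_lift_def span_singleton_scale)
  show "H x v1 \<noteq> 0"
  proof
    assume "H x v1 = 0"
    with eq have "(- H x v2) *s v1 = x" by simp
    then show False using span assms by (metis is_lift_def)
  qed
  show "H x v2 \<noteq> 0"
  proof
    assume "H x v2 = 0"
    with eq have "(- H x v1) *s v2 = x" by simp
    then show False using span assms by (metis is_lift_def)
  qed
qed

lemma negative_coordinates_nonzero:
  assumes "Re (H x x) < 0"
  shows "H x v1 \<noteq> 0" "H x v2 \<noteq> 0"
  using null_negative_nonzero[OF null(1) nonzero(1) assms] null_negative_nonzero[OF null(2) nonzero(2) assms]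
    conj_sym[of v1 x] conj_sym[of v2 x] by auto

section \<open>The geodesic with given endpoints\<close>

text \<open>The parameter \<open>r\<close> enters only through a completed square divided by \<open>r\<close>, which exhibits the
  minimum at \<open>r = height x\<close>.\<close>

lemma cosh_hdist_axis:
  assumes "is_lift p x" "Re (H x x) < 0" "r > 0"
  shows "(cosh (hdist H p (axis_point r) / 2))\<^sup>2 =
    ((r * cmod (H x v1) - cmod (H x v2))\<^sup>2 / r + 2 * cmod (H x v1) * cmod (H x v2)
      + 2 * Re (H x v1 * cnj (H x v2))) / (- 2 * Re (H x x))"
proof -
  have "(cmod (of_real r * H x v1 + H x v2))\<^sup>2 =
      r\<^sup>2 * (cmod (H x v1))\<^sup>2 + (cmod (H x v2))\<^sup>2 + 2 * r * Re (H x v1 * cnj (H x v2))"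
    unfolding cmod_power2 by (simp add: power2_eq_square algebra_simps)
  also have "\<dots> = r * ((r * cmod (H x v1) - cmod (H x v2))\<^sup>2 / r + 2 * cmod (H x v1) * cmod (H x v2)
      + 2 * Re (H x v1 * cnj (H x v2)))" (is "_ = r * ?E")
    using assms(3) by (simp add: power2_eq_square field_simps)
  finally have "(cosh (hdist H p (axis_point r) / 2))\<^sup>2 = r * ?E / (r * (- 2 * Re (H x x)))"
    using cosh_hdist(1)[OF assms(1) is_lift_axis assms(2), of r] assms(3)
    by (simp add: axis_vec_prods mult_ac)
  then show ?thesis using assms(3) by simp
qed

lemma axis_projection_unique:
  assumes "is_lift p x" "Re (H x x) < 0" "r > 0" "r \<noteq> height x"
  shows "hdist H p (axis_point (height x)) < hdist H p (axis_point r)"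
proof -
  have nz: "H x v1 \<noteq> 0" "H x v2 \<noteq> 0" using negative_coordinates_nonzero assms by auto
  then have h: "height x > 0" "height x * cmod (H x v1) = cmod (H x v2)"
    by (auto simp: height_def)
  have "r * cmod (H x v1) \<noteq> cmod (H x v2)"
    using assms(4) nz by (metis height_def nonzero_eq_divide_eq norm_eq_zero)
  then have "(r * cmod (H x v1) - cmod (H x v2))\<^sup>2 / r > 0" using assms(3) by simp
  then have "(cosh (hdist H p (axis_point (height x)) / 2))\<^sup>2 < (cosh (hdist H p (axis_point r) / 2))\<^sup>2"
    unfolding cosh_hdist_axis[OF assms(1,2) h(1)] cosh_hdist_axis[OF assms(1,2,3)] h(2)
    using assms(2) by (intro divide_strict_right_mono) auto
  then have "cosh (hdist H p (axis_point (height x)) / 2) < cosh (hdist H p (axis_point r) / 2)"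
    by (rule power_less_imp_less_base) simp
  moreover have "hdist H p (axis_point t) \<ge> 0" if "t > 0" for t
    using cosh_hdist(2)[OF assms(1) is_lift_axis assms(2)] that by (simp add: axis_vec_prods)
  ultimately show ?thesis
    using h(1) assms(3) by (subst (asm) cosh_real_nonneg_less_iff) auto
qed

lemma standard_geodesic:
  "is_geodesic_with_endpoints H (vec.span {v1}) (vec.span {v2}) (\<lambda>t. axis_point (exp (- t)))"
  unfolding is_geodesic_with_endpoints_def
proof (intro conjI allI)
  show "axis_point (exp (- t)) \<in> H2C H" for t by (simp add: axis_point_H2C)
next
  fix s t :: real
  let ?d = "hdist H (axis_point (exp (- s))) (axis_point (exp (- t)))"
  have "(cosh (?d / 2))\<^sup>2 = (exp (-s) + exp (-t))\<^sup>2 / (4 * (exp (-s) * exp (-t)))"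
    using cosh_hdist(1)[OF is_lift_axis[of "exp (-s)"] is_lift_axis[of "exp (-t)"]]
    unfolding axis_vec_prods(3) norm_minus_cancel norm_of_real by simp
  also have "\<dots> = (cosh ((s - t) / 2))\<^sup>2"
  proof -
    have e: "exp (-s) = (exp (-s/2))\<^sup>2" "exp (-t) = (exp (-t/2))\<^sup>2"
      by (simp_all add: exp_double[symmetric])
    have c: "cosh ((s - t) / 2) = (exp (-t/2) / exp (-s/2) + exp (-s/2) / exp (-t/2)) / 2"
      by (simp add: cosh_def exp_diff[symmetric] field_simps)
    show ?thesis unfolding e c by (simp add: power2_eq_square field_simps)
  qed
  finally have "cosh (?d / 2) = cosh (\<bar>s - t\<bar> / 2)"
    using cosh_real_abs[of "(s - t) / 2"] by (simp add: power2_eq_iff_nonneg)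
  moreover have "?d \<ge> 0"
    using cosh_hdist(2)[OF is_lift_axis[of "exp (-s)"] is_lift_axis[of "exp (-t)"]]
    by (simp add: axis_vec_prods)
  ultimately show "?d = \<bar>s - t\<bar>" 
    using arcosh_cosh_real[of "?d / 2"] arcosh_cosh_real[of "\<bar>s - t\<bar> / 2"] by simp
next
  have "vec.span {axis_vec (exp (- t))} = vec.span {v1 + of_real (exp t) *s v2}" for t
    using span_singleton_scale[of "of_real (exp t)" "axis_vec (exp (- t))"]
    by (simp add: axis_vec_def vector_add_ldistrib vector_smult_assoc exp_minus flip: of_real_mult)
  moreover have "((\<lambda>t::real. v1 + of_real (exp t) *s v2) \<longlongrightarrow> v1 + of_real 0 *s v2) at_bot"
    unfolding vector_scalar_mult_def by (intro tendsto_intros exp_at_bot)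
  ultimately show "limitin cp2_topology (\<lambda>t. axis_point (exp (- t))) (vec.span {v1}) at_bot"
    using limitin_cp2_span[of "\<lambda>t::real. v1 + of_real (exp t) *s v2" v1 at_bot] nonzero
    by (simp add: axis_point_def)
next
  have "((\<lambda>t::real. exp (- t)) \<longlongrightarrow> 0) at_top" by real_asymp
  then have "((\<lambda>t::real. axis_vec (exp (- t))) \<longlongrightarrow> of_real 0 *s v1 + v2) at_top"
    unfolding vector_scalar_mult_def axis_vec_def by (intro tendsto_intros)
  then show "limitin cp2_topology (\<lambda>t. axis_point (exp (- t))) (vec.span {v2}) at_top"
    using limitin_cp2_span[of "\<lambda>t::real. axis_vec (exp (- t))" v2 at_top] nonzero
    by (simp add: axis_point_def)
qed

text \<open>The endpoints and the isometry condition alone force a geodesic into the standard position, up to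
  a shift of the parameter, which is the factor \<open>k\<close>. The steps are the growth
  rates of the two coordinates, the bound \<open>K \<le> 1/2\<close> for their product, and the equality case of the
  inequality \<open>K \<ge> 1/2\<close>, which holds because the transverse component has non-negative norm.\<close>

lemma geodesic_on_axis:
  assumes "is_geodesic_with_endpoints H (vec.span {v1}) (vec.span {v2}) c"
  obtains k where "k > 0" "\<And>s. c s = axis_point (k * exp (- s))"
proof -
  have c: "\<And>t. c t \<in> H2C H" "\<And>s t. hdist H (c s) (c t) = \<bar>s - t\<bar>"
    "limitin cp2_topology c (vec.span {v1}) at_bot" "limitin cp2_topology c (vec.span {v2}) at_top"
    using assms by (auto simp: is_geodesic_with_endpoints_def)
  have "\<forall>t. \<exists>v. is_lift (c t) v \<and> Re (H v v) = -1"
    using H2C_unit_lift c(1) by metis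
  then obtain C where C: "\<And>t. is_lift (c t) (C t)" "\<And>t. Re (H (C t) (C t)) = -1"
    by metis
  have neg: "Re (H (C t) (C t)) < 0" for t by (simp add: C)
  have prods: "cmod (H (C s) (C t)) = cosh ((s - t) / 2)" for s t
  proof -
    have "(cosh (\<bar>s - t\<bar> / 2))\<^sup>2 = (cmod (H (C s) (C t)))\<^sup>2"
      using cosh_hdist(1)[OF C(1) C(1) neg neg, of s t] by (simp add: c C)
    then show ?thesis
      using cosh_real_abs[of "(s - t) / 2"] by (simp add: power2_eq_iff_nonneg)
  qed
  define a where "a s = H (C s) v2" for s
  define b where "b s = H (C s) v1" for s
  have nz: "a s \<noteq> 0" "b s \<noteq> 0" for s
    using negative_coordinates_nonzero[OF neg] by (auto simp: a_def b_def)
  have lifts: "is_lift (vec.span {v1}) v1" "is_lift (vec.span {v2}) v2"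
    using nonzero by (auto simp: is_lift_def)
  have b: "cmod (b s) = exp (s / 2) * cmod (b 0)" for s
  proof -
    have "((\<lambda>t. cosh (t / 2) / cosh ((t - s) / 2)) \<longlongrightarrow> exp (- (s / 2))) at_bot"
      by real_asymp (simp add: exp_minus inverse_eq_divide)
    from busemann_ratio[OF C(1) neg prods c(3) lifts(1) null(1) this]
    show ?thesis unfolding b_def by (simp flip: mult.assoc exp_add)
  qed
  have a: "cmod (a s) = exp (- (s / 2)) * cmod (a 0)" for s
  proof -
    have "((\<lambda>t. cosh (t / 2) / cosh ((t - s) / 2)) \<longlongrightarrow> exp (s / 2)) at_top"
      by real_asymp (simp add: exp_minus inverse_eq_divide)
    from busemann_ratio[OF C(1) neg prods c(4) lifts(2) null(2) this]
    show ?thesis unfolding a_def by (simp flip: mult.assoc exp_add)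
  qed
  define K where "K = cmod (a 0) * cmod (b 0)"
  have ba: "cmod (b s) * cmod (a t) = exp ((s - t) / 2) * K" for s t
  proof -
    have "exp ((s - t) / 2) = exp (s / 2) * exp (- (t / 2))"
      by (simp add: diff_divide_distrib flip: exp_add)
    then show ?thesis unfolding a[of t] b[of s] K_def by (simp only: mult_ac)
  qed
  have self: "Re (H (transverse (C s)) (transverse (C s))) \<le> 2 * K - 1" for s
  proof -
    have "Re (b s * cnj (a s)) \<le> cmod (b s) * cmod (a s)"
      using complex_Re_le_cmod[of "b s * cnj (a s)"] by (simp add: norm_mult)
    then show ?thesis using ba[of s s] C(2)[of s]
      by (simp add: transverse_norm flip: a_def b_def)
  qed
  have growth: "exp s * K \<le> (2 * K - 1) + cosh s + exp (- s) * K" for s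
  proof -
    let ?T = "H (transverse (C s)) (transverse (C (- s)))"
    have "2 * cmod ?T \<le> (2 * K - 1) + (2 * K - 1)"
      using perp_prod_bound[of "transverse (C s)" "transverse (C (- s))"] self[of s] self[of "-s"]
      by (simp add: transverse_perp)
    moreover have "b s * cnj (a (- s)) = ?T - H (C s) (C (- s)) - a s * cnj (b (- s))"
      by (simp add: transverse_prod flip: a_def b_def)
    then have "cmod (b s * cnj (a (- s))) \<le> cmod ?T + cmod (H (C s) (C (- s))) + cmod (a s * cnj (b (- s)))"
      by (metis norm_triangle_ineq4 add_right_mono order_trans)
    then have "cmod (b s) * cmod (a (- s)) \<le> cmod ?T + cosh s + cmod (b (- s)) * cmod (a s)"
      by (simp add: norm_mult prods mult.commute)
    ultimately show ?thesis by (simp add: ba)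
  qed
  have K: "K \<le> 1 / 2"
  proof (rule ccontr)
    assume K: "\<not> ?thesis"
    \<comment> \<open>for large \<open>x = exp s\<close> the leading term \<open>(K - 1/2) x\<close> contradicts \<open>growth\<close>; this \<open>x\<close> is large enough\<close>
    define x where "x = 3 * K / (K - 1 / 2)"
    have x: "x \<ge> 1" using K by (simp add: x_def field_simps)
    have "x * K \<le> (2 * K - 1) + (x + inverse x) / 2 + inverse x * K"
      using growth[of "ln x"] x by (simp add: cosh_def exp_minus)
    moreover have "inverse x * (1 / 2 + K) \<le> 1 * (1 / 2 + K)"
      using x K by (intro mult_right_mono) (auto simp: inverse_le_1_iff)
    ultimately have "x * (K - 1 / 2) \<le> 3 * K - 1 / 2" by (simp add: algebra_simps add_divide_distrib)
    then show False using K by (simp add: x_def)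
  qed
  show ?thesis
  proof (rule that[of "cmod (a 0) / cmod (b 0)"])
    show "cmod (a 0) / cmod (b 0) > 0" using nz by simp
    fix s
    let ?r = "cmod (a 0) / cmod (b 0) * exp (- s)"
    \<comment> \<open>\<open>b s * cnj (a s)\<close> has real part at least \<open>1/2\<close> and modulus at most \<open>1/2\<close>, so it equals \<open>1/2\<close>\<close>
    have "Re (H (transverse (C s)) (transverse (C s))) \<ge> 0"
      by (intro perp_nonneg transverse_perp)
    then have re: "2 * Re (b s * cnj (a s)) \<ge> 1"
      using C(2)[of s] by (simp add: transverse_norm flip: a_def b_def)
    have le: "cmod (b s * cnj (a s)) \<le> 1 / 2"
      using ba[of s s] K by (simp add: norm_mult)
    then have re_half: "Re (b s * cnj (a s)) = 1 / 2" and half: "cmod (b s * cnj (a s)) = 1 / 2"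
      using re complex_Re_le_cmod[of "b s * cnj (a s)"] by linarith+
    have "(Im (b s * cnj (a s)))\<^sup>2 = 0"
      using cmod_power2[of "b s * cnj (a s)"] unfolding half re_half by linarith
    then have "Im (b s * cnj (a s)) = 0" by (simp only: power_eq_0_iff)
    with re_half have "b s * cnj (a s) = of_real (1 / 2)"
      by (simp only: complex_eq_iff Re_complex_of_real Im_complex_of_real)
    then have "cnj (b s * cnj (a s)) = of_real (1 / 2)"
      by (simp only: complex_cnj_complex_of_real)
    moreover have "cmod (a s) * cmod (b s) = 1 / 2"
      using half by (simp add: norm_mult mult.commute)
    ultimately have prod_half: "a s * cnj (b s) = of_real (cmod (a s) * cmod (b s))"
      by (simp only: complex_cnj_mult complex_cnj_cnj mult.commute)
    have "of_real (cmod (b s)) * of_real (cmod (b s)) = b s * cnj (b s)"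
      by (simp add: complex_norm_square[symmetric] power2_eq_square)
    then have "(of_real (cmod (b s)) * of_real (cmod (b s))) * a s = (a s * cnj (b s)) * b s"
      by simp
    then have "a s = of_real (cmod (a s) / cmod (b s)) * b s"
      unfolding prod_half using nz[of s] by (simp add: field_simps)
    moreover have "cmod (a s) / cmod (b s) = ?r"
    proof -
      have "exp (- s) = exp (- (s / 2)) / exp (s / 2)"
        by (simp flip: exp_diff)
      then show ?thesis unfolding a[of s] b[of s] by (simp add: mult.commute)
    qed
    ultimately have as: "a s = of_real ?r * b s" by simp
    have "C s = - (a s *s v1 + b s *s v2)"
      unfolding a_def b_def
    proof (rule transverse_zero)
      show "Re (H (C s) (C s)) + 2 * Re (H (C s) v1 * cnj (H (C s) v2)) \<le> 0"
        unfolding a_def[symmetric] b_def[symmetric]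
        using C(2)[of s] le complex_Re_le_cmod[of "b s * cnj (a s)"] by linarith
    qed
    also have "\<dots> = (- b s) *s axis_vec ?r"
      unfolding as by (simp add: axis_vec_def vector_add_ldistrib vector_smult_assoc mult.commute)
    finally have "vec.span {C s} = axis_point ?r"
      using nz[of s] span_singleton_scale[of "- b s"] by (simp add: axis_point_def)
    then show "c s = axis_point ?r" using C(1)[of s] by (simp add: is_lift_def)
  qed
qed

lemma geodesic_eq: "geodesic H (vec.span {v1}) (vec.span {v2}) = axis_point ` {0<..}"
proof -
  have "range c = axis_point ` {0<..}"
    if "is_geodesic_with_endpoints H (vec.span {v1}) (vec.span {v2}) c" for c
  proof -
    from geodesic_on_axis[OF that]
    obtain k where k: "k > 0" "\<And>s. c s = axis_point (k * exp (- s))" by blast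
    have "range (\<lambda>s. k * exp (- s)) = {0<..}"
    proof (intro set_eqI iffI)
      fix r :: real assume "r \<in> {0<..}"
      then have "r = k * exp (- (- ln (r / k)))" using k(1) by simp
      then show "r \<in> range (\<lambda>s. k * exp (- s))" by blast
    qed (use k(1) in auto)
    then show ?thesis unfolding k(2) by (metis image_image)
  qed
  then show ?thesis
    unfolding geodesic_def using standard_geodesic by (intro the_equality) blast+
qed

section \<open>The projection and its extension to the boundary\<close>

lemma proj_geodesic_eq:
  assumes "is_lift p x" "Re (H x x) < 0"
  shows "proj_geodesic H (vec.span {v1}) (vec.span {v2}) p = axis_point (height x)"
proof -
  have h: "height x > 0"
    using negative_coordinates_nonzero[OF assms(2)] by (simp add: height_def)
  note less = axis_projection_unique[OF assms]
  show ?thesis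
    unfolding proj_geodesic_def geodesic_eq is_arg_min_def
  proof (rule the_equality)
    show "axis_point (height x) \<in> axis_point ` {0<..} \<and>
        (\<nexists>y. y \<in> axis_point ` {0<..} \<and> hdist H p y < hdist H p (axis_point (height x)))"
      using h less by (auto dest: order.asym)
  next
    fix q assume "q \<in> axis_point ` {0<..} \<and>
        (\<nexists>y. y \<in> axis_point ` {0<..} \<and> hdist H p y < hdist H p q)"
    then show "q = axis_point (height x)" using h less by force
  qed
qed

text \<open>Limits at a boundary point along \<open>H2C H\<close> are unique only if the filter is proper. For a null
  vector \<open>x\<close> and a negative vector \<open>n\<close> with \<open>Re (H x n) \<le> 0\<close>, which can be achieved by changing
  the sign of \<open>n\<close>, the vectors \<open>x + e n\<close> with \<open>e > 0\<close> are negative and tend to \<open>x\<close>.\<close>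

lemma boundary_accumulation:
  assumes "p \<in> bdH2C H"
  shows "atin_within cp2_topology p (H2C H) \<noteq> bot"
proof
  assume "atin_within cp2_topology p (H2C H) = bot"
  then have "eventually (\<lambda>_. False) (atin_within cp2_topology p (H2C H))" by simp
  moreover obtain x where x: "is_lift p x" "H x x = 0" using assms by (auto simp: bdH2C_def)
  then have "p \<in> topspace cp2_topology" by (auto simp: CP2_def)
  ultimately obtain T where T: "openin cp2_topology T" "p \<in> T" "\<And>y. y \<in> T \<Longrightarrow> y \<notin> H2C H"
    using null_not_negative[OF assms] unfolding eventually_atin_within by blast
  obtain n where n: "Re (H n n) < 0" "Re (H x n) \<le> 0"
  proof (cases "Re (H x (axis_vec 1)) \<le> 0")
    case True
    then show ?thesis using that[of "axis_vec 1"] axis_vec_prods(3)[of 1 1] by simp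
  next
    case False
    then show ?thesis using that[of "- axis_vec 1"] axis_vec_prods(3)[of 1 1]
      by (simp add: uminus_left uminus_right)
  qed
  have "((\<lambda>e::real. x + of_real e *s n) \<longlongrightarrow> x + of_real 0 *s n) (at_right 0)"
    unfolding vector_scalar_mult_def by (intro tendsto_intros)
  then have "limitin cp2_topology (\<lambda>e::real. vec.span {x + of_real e *s n}) p (at_right 0)"
    using limitin_cp2_span[of "\<lambda>e::real. x + of_real e *s n" x] x by (simp add: is_lift_def)
  then have "\<forall>\<^sub>F e::real in at_right 0. vec.span {x + of_real e *s n} \<in> T"
    using T by (simp add: limitin_def)
  then have "\<forall>\<^sub>F e::real in at_right 0. False"
    using eventually_at_right_less
  proof eventually_elim
    case (elim e)
    let ?y = "x + of_real e *s n"
    have "H n x = cnj (H x n)" by (rule conj_sym)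
    then have "Re (H ?y ?y) = e * (2 * Re (H x n) + e * Re (H n n))"
      using x(2) by (simp add: form_simps algebra_simps)
    also have "\<dots> < 0"
      using n elim(2) by (intro mult_pos_neg add_nonpos_neg) (auto intro: mult_pos_neg)
    finally have neg: "Re (H ?y ?y) < 0" .
    then have "?y \<noteq> 0" by auto
    then have "vec.span {?y} \<in> H2C H"
      using neg unfolding H2C_def is_lift_def by blast
    then show ?case using T(3) elim(1) by blast
  qed
  then show False by simp
qed

text \<open>The height has degree zero, so it passes to the limit in the projective plane. This gives the
  existence of the limit of the projections. It also gives its uniqueness, since the height
  recovers the parameter of a point of the geodesic.\<close>

lemma proj_geodesic_bd_eq:
  assumes x: "is_lift p x" "H x x = 0" and p: "p \<noteq> vec.span {v1}" "p \<noteq> vec.span {v2}"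
  shows "proj_geodesic_bd H (vec.span {v1}) (vec.span {v2}) p = axis_point (height x)"
proof -
  let ?F = "atin_within cp2_topology p (H2C H)"
  let ?pr = "proj_geodesic H (vec.span {v1}) (vec.span {v2})"
  have nz: "H x v1 \<noteq> 0" "H x v2 \<noteq> 0" using null_coordinates_nonzero[OF x p] by auto
  have bd: "p \<in> bdH2C H" using x by (auto simp: bdH2C_def)
  have "\<forall>\<^sub>F y in ?F. y \<in> H2C H"
    unfolding eventually_atin_within by (metis openin_topspace)
  then have ev: "\<forall>\<^sub>F y in ?F. is_lift y (lift y) \<and> ?pr y = axis_point (height (lift y)) \<and> height (lift y) > 0"
  proof eventually_elim
    case (elim y)
    then show ?case
      using lift_H2C[OF elim] proj_geodesic_eq negative_coordinates_nonzero[of "lift y"]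
      by (simp add: height_def)
  qed
  have id: "limitin cp2_topology (\<lambda>y. y) p ?F"
    using x(1) unfolding limitin_def eventually_atin_within by (auto simp: CP2_def)
  have h: "((\<lambda>y. height (lift y)) \<longlongrightarrow> height x) ?F"
    using id _ x(1) isCont_height[OF nz(1)]
    by (rule tendsto_of_limitin_cp2) (use ev in \<open>auto elim: eventually_mono simp: height_scale\<close>)
  show ?thesis
    unfolding proj_geodesic_bd_def
  proof (rule the_equality)
    have "((\<lambda>y. axis_vec (height (lift y))) \<longlongrightarrow> axis_vec (height x)) ?F"
      unfolding axis_vec_def vector_scalar_mult_def by (intro tendsto_intros h)
    then have "limitin cp2_topology (\<lambda>y. axis_point (height (lift y))) (axis_point (height x)) ?F"
      unfolding axis_point_def using axis_vec_nonzero by (rule limitin_cp2_span)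
    then have "limitin cp2_topology ?pr (axis_point (height x)) ?F"
      by (rule limitin_transform_eventually[rotated]) (use ev in \<open>auto elim: eventually_mono\<close>)
    then show "limitin (subtopology cp2_topology (geodesic H (vec.span {v1}) (vec.span {v2})))
        ?pr (axis_point (height x)) ?F"
      unfolding limitin_subtopology geodesic_eq
      using nz ev by (auto simp: height_def elim: eventually_mono)
  next
    fix q
    assume "limitin (subtopology cp2_topology (geodesic H (vec.span {v1}) (vec.span {v2}))) ?pr q ?F"
    then obtain r where r: "r > 0" "q = axis_point r" and lim: "limitin cp2_topology ?pr q ?F"
      unfolding limitin_subtopology geodesic_eq by auto
    have "((\<lambda>y. height (axis_vec (height (lift y)))) \<longlongrightarrow> height (axis_vec r)) ?F"
      using lim _ is_lift_axis[of r, folded r(2)]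
    proof (rule tendsto_of_limitin_cp2)
      show "\<forall>\<^sub>F y in ?F. is_lift (?pr y) (axis_vec (height (lift y)))"
        using ev by eventually_elim (simp add: is_lift_axis)
    qed (auto intro: isCont_height simp: height_scale axis_vec_prods)
    then have "((\<lambda>y. height (lift y)) \<longlongrightarrow> r) ?F"
      using r(1) by (simp add: height_axis height_def[of "lift _"])
    then have "r = height x"
      using h boundary_accumulation[OF bd] tendsto_unique by blast
    then show "q = axis_point (height x)" using r by simp
  qed
qed

end

section \<open>Balanced tetrahedra\<close>

theorem proposition2p9:
  fixes H :: "complex^3 \<Rightarrow> complex^3 \<Rightarrow> complex"
    and p1 p2 p3 p4 :: point
  assumes "hermitian_form H" and "signature_2_1 H"
    and "(p1, p2, p3, p4) \<in> ideal_tetrahedra H"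
    and "p1 \<noteq> p2" and "p3 \<notin> {p1, p2}" and "p4 \<notin> {p1, p2}"
  shows "balanced H (p1, p2, p3, p4) \<longleftrightarrow> cmod (cross_ratio H p1 p2 p3 p4) = 1"
proof -
  interpret signature_21_form H
    using assms(1,2) by unfold_locales
  obtain u1 v2 x3 x4 where lifts: "is_lift p1 u1" "is_lift p2 v2" "is_lift p3 x3" "is_lift p4 x4"
    and self: "H u1 u1 = 0" "H v2 v2 = 0" "H x3 x3 = 0" "H x4 x4 = 0"
    using assms(3) by (auto simp: ideal_tetrahedra_def bdH2C_def)
  have nz: "H u1 v2 \<noteq> 0"
  proof
    assume "H u1 v2 = 0"
    then obtain c where "c \<noteq> 0" "v2 = c *s u1"
      using orthogonal_nonpositive_dependent[of u1 v2] lifts self by (auto simp: is_lift_def)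
    then show False
      using lifts(1,2) assms(4) by (simp add: is_lift_def span_singleton_scale)
  qed
  define v1 where "v1 = (- 1 / H u1 v2) *s u1"
  have v1: "is_lift p1 v1" unfolding v1_def using lifts(1) nz by (intro is_lift_scale) auto
  interpret null_pair H v1 v2
    by unfold_locales (use self nz in \<open>simp_all add: v1_def form_simps uminus_left uminus_right\<close>)
  have p: "p1 = vec.span {v1}" "p2 = vec.span {v2}" using v1 lifts(2) by (auto simp: is_lift_def)
  have nz3: "H x3 v1 \<noteq> 0" "H x3 v2 \<noteq> 0"
    using null_coordinates_nonzero[OF lifts(3) self(3)] assms(5) p by auto
  have nz4: "H x4 v1 \<noteq> 0" "H x4 v2 \<noteq> 0"
    using null_coordinates_nonzero[OF lifts(4) self(4)] assms(6) p by auto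
  have "balanced H (p1, p2, p3, p4) \<longleftrightarrow> axis_point (height x3) = axis_point (height x4)"
    using proj_geodesic_bd_eq[OF lifts(3) self(3)] proj_geodesic_bd_eq[OF lifts(4) self(4)]
      assms(5,6) p by simp
  also have "\<dots> \<longleftrightarrow> height x3 = height x4"
    using axis_point_inject by (auto simp: height_def)
  also have "\<dots> \<longleftrightarrow> cmod (cross_ratio H p1 p2 p3 p4) = 1"
    using nz3 nz4
    by (auto simp: cross_ratio_lifts[OF herm v1 lifts(2-4)] height_def norm_mult norm_divide field_simps)
  finally show ?thesis .
qed

end
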